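(* Let $\varepsilon>0$ and $\eta_0<\eta_1<f^*$, and suppose that $\beta\in(1/2,1]$ and $\alpha\in(1,2\sqrt\beta)$. Let $\{(\eta_t,l_t,u_t)\}$ be generated by the Truncated Inexact Secant method described in the context. Then $\{\eta_t\}$ is a monotonically increasing sequence with $\eta_t\le f^*$ for all $t>0$. Moreover, with $\bar V'=\min\{\xi:\xi\in\partial V(f^* )\}$ and $\sigma=1+\frac\beta\alpha\bar V'$, the contraction property $$f^*-\eta_t\le\sigma\,(f^*-\eta_{t-1}),\qquad t=1,2,\dots,$$ holds. Suppose $\eta_1$ is obtained from $\eta_0$ by one step of fixed point iteration (defined in the context). Then the total iteration number of the method for an $\varepsilon$-optimal solution is bounded by $$T^{\rm SC}_\varepsilon=\Big\lceil\min\Big\{\frac{\alpha}{-\beta\bar V'}\log\Big(\frac{\alpha V(\eta_0)}{-\bar V'\varepsilon}\Big),\ \log_{2\sqrt\beta/\alpha}\Big(\frac{\alpha l_0}{\varepsilon}\sqrt{\frac{f^*-\eta_0}{\eta_1-\eta_0}}\Big)\Big\}\Big\rceil .$$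
   Context: $\mathcal X\subseteq\mathbb R^d$ is nonempty, closed and convex; $f,g_1,\dots,g_m:\mathbb R^d\to\mathbb R$ are convex; $f^*=\min\{f(x):x\in\mathcal X,\ g_i(x)\le0,\ 1\le i\le m\}$. A point $x\in\mathcal X$ is $\varepsilon$-optimal if $f(x)-f^*\le\varepsilon$ and $\max_{1\le i\le m}\max\{g_i(x),0\}\le\varepsilon$. $v(x,\eta)=\max\{f(x)-\eta,g_1(x),\dots,g_m(x)\}$ and $V(\eta)=\min_{x\in\mathcal X}v(x,\eta)$ for $\eta\in\mathbb R$. $\partial V$ is the convex subdifferential. Truncated Inexact Secant method: given $\eta_0<\eta_1<f^*$, obtain $(l_0,u_0)$ and $(l_1,u_1)$ with $0<l_t\le V(\eta_t)\le u_t$ and $\frac{u_t}{l_t}\le\alpha$ for $t=0,1$. For $t=2,3,\dots$: set $\eta_t=\eta_{t-1}+\beta\max\{1,-\frac{\eta_{t-2}-\eta_{t-1}}{u_{t-2}-l_{t-1}}\}\,l_{t-1}$; find a pair $(l_t,u_t)$ with $\frac{u_t}{l_t}\le\alpha$, $0<l_t\le V(\eta_t)\le u_t$ and $u_t\le u_{t-1}$; stop if $u_t\le\varepsilon$ (the method's accuracy test). One step of fixed point iteration from $\eta_0$: set $\eta_1=\eta_0+\beta l_0$ and find a pair $(l_1,u_1)$ with $\frac{u_1}{l_1}\le\alpha$, $0<l_1\le V(\eta_1)\le u_1$ and $u_1\le u_0$.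
   Formalization: Contraction at t=1 holds only if η_1 comes from the fixed point step (false for arbitrary η_1); if u_1≤ε, where T may be below 2, the method is shown to stop by iteration 2; if V̄'=0, the undefined first term of the minimum is read as +∞. *)

theory Defs
  imports "HOL-Analysis.Analysis"
begin

text \<open>Minimum of a set of reals. Unlike the infimum it is only meaningful when it is
  attained, which is what \<open>has_min\<close> records.\<close>

definition has_min :: "real set \<Rightarrow> bool" where
  "has_min S \<longleftrightarrow> (\<exists>s\<in>S. \<forall>r\<in>S. s \<le> r)"

definition min_of :: "real set \<Rightarrow> real" where
  "min_of S = (LEAST s. s \<in> S)"

definition subdiff :: "(real \<Rightarrow> real) \<Rightarrow> real \<Rightarrow> real set" where
  "subdiff h x = {\<xi>. \<forall>y. h y \<ge> h x + \<xi> * (y - x)}"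

text \<open>The constraints are \<open>g 1, \<dots>, g m\<close>; the other values of \<open>g\<close> are irrelevant.\<close>

definition feasible ::
  "(real^'d) set \<Rightarrow> (nat \<Rightarrow> real^'d \<Rightarrow> real) \<Rightarrow> nat \<Rightarrow> (real^'d) set" where
  "feasible X g m = {x \<in> X. \<forall>i\<in>{1..m}. g i x \<le> 0}"

definition opt_value ::
  "(real^'d) set \<Rightarrow> (real^'d \<Rightarrow> real) \<Rightarrow> (nat \<Rightarrow> real^'d \<Rightarrow> real) \<Rightarrow> nat \<Rightarrow> real" where
  "opt_value X f g m = min_of (f ` feasible X g m)"

definition eps_optimal ::
  "(real^'d) set \<Rightarrow> (real^'d \<Rightarrow> real) \<Rightarrow> (nat \<Rightarrow> real^'d \<Rightarrow> real) \<Rightarrow> nat \<Rightarrow> real \<Rightarrow> real^'d \<Rightarrow> bool"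
  where
  "eps_optimal X f g m \<epsilon> x \<longleftrightarrow>
     x \<in> X \<and> f x - opt_value X f g m \<le> \<epsilon> \<and> (\<forall>i\<in>{1..m}. max (g i x) 0 \<le> \<epsilon>)"

definition level_fun ::
  "(real^'d \<Rightarrow> real) \<Rightarrow> (nat \<Rightarrow> real^'d \<Rightarrow> real) \<Rightarrow> nat \<Rightarrow> real^'d \<Rightarrow> real \<Rightarrow> real" where
  "level_fun f g m x \<eta> = Max (insert (f x - \<eta>) ((\<lambda>i. g i x) ` {1..m}))"

definition value_fun ::
  "(real^'d) set \<Rightarrow> (real^'d \<Rightarrow> real) \<Rightarrow> (nat \<Rightarrow> real^'d \<Rightarrow> real) \<Rightarrow> nat \<Rightarrow> real \<Rightarrow> real" where
  "value_fun X f g m \<eta> = min_of ((\<lambda>x. level_fun f g m x \<eta>) ` X)"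

definition bracket :: "(real \<Rightarrow> real) \<Rightarrow> real \<Rightarrow> real \<Rightarrow> real \<Rightarrow> real \<Rightarrow> bool" where
  "bracket V \<alpha> \<eta> l u \<longleftrightarrow> 0 < l \<and> l \<le> V \<eta> \<and> V \<eta> \<le> u \<and> u / l \<le> \<alpha>"

text \<open>The pair at step \<open>t\<close> has been found. For the two starting pairs only the bracketing
  property is required; the requirement \<open>u t \<le> u (t - 1)\<close> belongs to the main loop.\<close>

definition pair_found ::
  "(real \<Rightarrow> real) \<Rightarrow> real \<Rightarrow> (nat \<Rightarrow> real) \<Rightarrow> (nat \<Rightarrow> real) \<Rightarrow> (nat \<Rightarrow> real) \<Rightarrow> nat \<Rightarrow> bool" where
  "pair_found V \<alpha> \<eta> l u t \<longleftrightarrow>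
     bracket V \<alpha> (\<eta> t) (l t) (u t) \<and> (2 \<le> t \<longrightarrow> u t \<le> u (t - 1))"

text \<open>The Truncated Inexact Secant method has entered iteration \<open>N\<close>, i.e. \<open>\<eta> 0, \<dots>, \<eta> N\<close> have
  been computed, and every earlier iteration \<open>t \<ge> 2\<close> found its pair and failed the stopping
  test. No pair at iteration \<open>N\<close> itself is presupposed (beyond the starting pairs): if
  \<open>\<eta> N\<close> hits the optimal value exactly, there is none, since then \<open>V (\<eta> N) = 0\<close>.
  Values of the three sequences beyond \<open>N\<close> are arbitrary.\<close>

definition secant_run ::
  "(real \<Rightarrow> real) \<Rightarrow> real \<Rightarrow> real \<Rightarrow> real \<Rightarrow> (nat \<Rightarrow> real) \<Rightarrow> (nat \<Rightarrow> real) \<Rightarrow> (nat \<Rightarrow> real) \<Rightarrow> nat \<Rightarrow> bool"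
  where
  "secant_run V \<alpha> \<beta> \<epsilon> \<eta> l u N \<longleftrightarrow>
     1 \<le> N \<and> pair_found V \<alpha> \<eta> l u 0 \<and> pair_found V \<alpha> \<eta> l u 1 \<and>
     (\<forall>t\<in>{2..N}. \<eta> t = \<eta> (t - 1) +
        \<beta> * max 1 (- ((\<eta> (t - 2) - \<eta> (t - 1)) / (u (t - 2) - l (t - 1)))) * l (t - 1)) \<and>
     (\<forall>t\<in>{2..<N}. pair_found V \<alpha> \<eta> l u t \<and> \<not> u t \<le> \<epsilon>)"

definition fixed_point_start ::
  "(real \<Rightarrow> real) \<Rightarrow> real \<Rightarrow> real \<Rightarrow> (nat \<Rightarrow> real) \<Rightarrow> (nat \<Rightarrow> real) \<Rightarrow> (nat \<Rightarrow> real) \<Rightarrow> bool" where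
  "fixed_point_start V \<alpha> \<beta> \<eta> l u \<longleftrightarrow>
     \<eta> 1 = \<eta> 0 + \<beta> * l 0 \<and> bracket V \<alpha> (\<eta> 1) (l 1) (u 1) \<and> u 1 \<le> u 0"

text \<open>The iteration bound; \<open>D\<close> is the minimal subgradient of \<open>V\<close> at \<open>fstar\<close>, with \<open>D \<le> 0\<close>.
  It can be \<open>0\<close> (e.g. minimize \<open>x\<close> subject to \<open>x\<^sup>2 \<le> 0\<close>). Then the first term of the minimum is
  read as \<open>+\<infinity>\<close>, its limit as \<open>D\<close> increases to \<open>0\<close>; HOL division by zero would make it \<open>0\<close>.\<close>

definition secant_bound ::
  "(real \<Rightarrow> real) \<Rightarrow> real \<Rightarrow> real \<Rightarrow> real \<Rightarrow> real \<Rightarrow> real \<Rightarrow> real \<Rightarrow> real \<Rightarrow> real \<Rightarrow> int" where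
  "secant_bound V fstar D \<alpha> \<beta> \<epsilon> \<eta>0 \<eta>1 l0 =
     (let A = \<alpha> / (- \<beta> * D) * ln (\<alpha> * V \<eta>0 / (- D * \<epsilon>));
          B = log (2 * sqrt \<beta> / \<alpha>) (\<alpha> * l0 / \<epsilon> * sqrt ((fstar - \<eta>0) / (\<eta>1 - \<eta>0)))
      in \<lceil>if D = 0 then B else min A B\<rceil>)"

end

theory Submission
  imports Defs
begin

text \<open>The value function \<open>V\<close> is convex, nonincreasing, has slopes at least \<open>-1\<close>, is positive to the left
  of \<open>f\<^sup>*\<close> and vanishes there. Hence both the fixed point step and the secant through
  \<open>(\<eta>\<^bsub>t-2\<^esub>, u\<^bsub>t-2\<^esub>)\<close> and \<open>(\<eta>\<^bsub>t-1\<^esub>, l\<^bsub>t-1\<^esub>)\<close> undershoot \<open>f\<^sup>*\<close>, while the subgradient inequality at \<open>f\<^sup>*\<close>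
  makes a step of length at least \<open>\<beta> l\<^bsub>t-1\<^esub>\<close> contract the gap by \<open>\<sigma>\<close>. For the second bound put
  \<open>\<Delta>\<^sub>t = \<eta>\<^sub>t - \<eta>\<^bsub>t-1\<^esub>\<close>. The secant step gives
  \<open>u\<^bsub>t-1\<^esub> / l\<^sub>t \<ge> 1 + \<beta> \<Delta>\<^sub>t / \<Delta>\<^bsub>t+1\<^esub> \<ge> 2 sqrt (\<beta> \<Delta>\<^sub>t / \<Delta>\<^bsub>t+1\<^esub>)\<close>, so \<open>l\<^sub>t / sqrt \<Delta>\<^bsub>t+1\<^esub>\<close> decreases
  geometrically with ratio \<open>\<alpha> / (2 sqrt \<beta>)\<close>, and \<open>\<Delta>\<^bsub>t+1\<^esub> \<le> f\<^sup>* - \<eta>\<^sub>0\<close>.\<close>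

section \<open>Attained minima and convexity on the line\<close>

lemma min_of_properties:
  assumes "has_min S"
  shows "min_of S \<in> S" and "\<And>r. r \<in> S \<Longrightarrow> min_of S \<le> r"
proof -
  obtain s where s: "s \<in> S" "\<And>r. r \<in> S \<Longrightarrow> s \<le> r"
    using assms by (auto simp: has_min_def)
  have "min_of S = s"
    unfolding min_of_def using s by (intro Least_equality) auto
  with s show "min_of S \<in> S" "\<And>r. r \<in> S \<Longrightarrow> min_of S \<le> r"
    by auto
qed

text \<open>Convexity with weight \<open>(b - a) / (c - a)\<close>, cleared of denominators; in
  every use one of the three values vanishes.\<close>

lemma convex_on_three_points:
  fixes h :: "real \<Rightarrow> real"
  assumes "convex_on UNIV h" "a < b" "b < c"
  shows "(c - a) * h b \<le> (c - b) * h a + (b - a) * h c"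
proof -
  define s where "s = (b - a) / (c - a)"
  have ca: "c - a > 0" using assms by simp
  have s: "0 \<le> s" "s \<le> 1" "s * (c - a) = b - a"
    using assms by (auto simp: s_def field_simps)
  have b: "(1 - s) *\<^sub>R a + s *\<^sub>R c = b"
    using s(3) by (simp add: algebra_simps)
  have "h b \<le> (1 - s) * h a + s * h c"
    using convex_onD[OF assms(1) s(1,2), of a c] by (simp only: b UNIV_I)
  then have "(c - a) * h b \<le> (c - a) * ((1 - s) * h a + s * h c)"
    using ca by (intro mult_left_mono) auto
  also have "\<dots> = ((c - a) - s * (c - a)) * h a + (s * (c - a)) * h c"
    by (simp add: algebra_simps)
  also have "\<dots> = (c - b) * h a + (b - a) * h c"
    by (simp only: s(3)) simp
  finally show ?thesis .
qed

section \<open>Convex nonincreasing functions to the left of their root\<close>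

locale decreasing_to_root =
  fixes V :: "real \<Rightarrow> real" and fstar :: real
  assumes convex_V: "convex_on UNIV V"
    and antimono_V: "antimono V"
    and V_slope: "\<And>a b. a \<le> b \<Longrightarrow> V a \<le> V b + (b - a)"
    and V_root: "V fstar = 0"
    and V_pos: "\<And>a. a < fstar \<Longrightarrow> 0 < V a"
begin

lemma V_pos_iff: "0 < V a \<longleftrightarrow> a < fstar"
  using V_pos antimonoD[OF antimono_V, of fstar a] V_root by fastforce

lemma V_le_gap: "a \<le> fstar \<Longrightarrow> V a \<le> fstar - a"
  using V_slope[of a fstar] V_root by simp

lemma V_chord:
  assumes "a < b" "b < fstar"
  shows "(fstar - a) * V b \<le> (fstar - b) * V a"
  using convex_on_three_points[OF convex_V assms] V_root by simp

lemma V_strict_decreasing: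
  assumes "a < b" "b < fstar"
  shows "V b < V a"
proof (rule ccontr)
  assume "\<not> V b < V a"
  then have "(fstar - b) * V a \<le> (fstar - b) * V b"
    using assms by (intro mult_left_mono) auto
  also have "\<dots> < (fstar - a) * V b"
    using assms V_pos[of b] by (intro mult_strict_right_mono) auto
  finally show False using V_chord[OF assms] by simp
qed

text \<open>The minimal subgradient is the left derivative at the root, the supremum of the chord
  slopes \<open>Q\<close> from the left. By convexity every chord slope on the right bounds
  \<open>Q\<close> above, so the supremum exists and is a subgradient.\<close>

lemma subdiff_root_has_min: "has_min (subdiff V fstar)"
proof -
  define Q where "Q = (\<lambda>y. V y / (y - fstar)) ` {..<fstar}"
  have upper: "V y / (y - fstar) \<le> V z / (z - fstar)" if "y < fstar" "fstar < z" for y z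
    using convex_on_three_points[OF convex_V that] V_root that by (simp add: field_simps)
  have bdd: "bdd_above Q"
    unfolding Q_def using upper[of _ "fstar + 1"] by (intro bdd_aboveI2) auto
  have ne: "Q \<noteq> {}" by (auto simp: Q_def)
  have left: "V y / (y - fstar) \<le> Sup Q" if "y < fstar" for y
    using that bdd by (intro cSup_upper) (auto simp: Q_def)
  have right: "Sup Q \<le> V z / (z - fstar)" if "fstar < z" for z
    using ne upper that by (intro cSup_least) (auto simp: Q_def)
  have "V y \<ge> V fstar + Sup Q * (y - fstar)" for y
    using left[of y] right[of y] V_root by (cases y fstar rule: linorder_cases) (auto simp: field_simps)
  then have "Sup Q \<in> subdiff V fstar" by (auto simp: subdiff_def)
  moreover have "Sup Q \<le> r" if "r \<in> subdiff V fstar" for r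
  proof (rule cSup_least[OF ne])
    fix q assume "q \<in> Q"
    then obtain y where y: "y < fstar" "q = V y / (y - fstar)" by (auto simp: Q_def)
    have "V y \<ge> r * (y - fstar)" using that V_root by (auto simp: subdiff_def)
    then show "q \<le> r" using y by (simp add: divide_le_eq)
  qed
  ultimately show ?thesis by (auto simp: has_min_def)
qed

text \<open>The subgradient inequality is tested at \<open>a\<close>, \<open>fstar + 1\<close> and
  \<open>fstar - 1\<close>. The first bound drives the contraction; the last one keeps its factor
  positive.\<close>

lemma min_subgradient:
  defines "D \<equiv> min_of (subdiff V fstar)"
  shows "- D * (fstar - a) \<le> V a" and "D \<le> 0" and "- 1 \<le> D"
proof -
  have "D \<in> subdiff V fstar"
    unfolding D_def by (rule min_of_properties(1)[OF subdiff_root_has_min])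
  then have sub: "V a \<ge> D * (a - fstar)" for a
    using V_root by (auto simp: subdiff_def)
  show "- D * (fstar - a) \<le> V a" using sub[of a] by (simp add: algebra_simps)
  show "D \<le> 0" using sub[of "fstar + 1"] antimonoD[OF antimono_V, of fstar "fstar + 1"] V_root by simp
  show "- 1 \<le> D" using sub[of "fstar - 1"] V_le_gap[of "fstar - 1"] by simp
qed

text \<open>The line through \<open>(a, u)\<close> and \<open>(b, l)\<close> vanishes at
  \<open>b + (b - a) / (u - l) * l\<close>. Raising the left value and lowering the right one moves
  this zero to the left, and the exact secant of a convex function already undershoots the
  root.\<close>

lemma secant_step_bound:
  assumes "a < b" "b < fstar" "V a \<le> u" "0 < l" "l \<le> V b"
  shows "l < u" and "(b - a) / (u - l) * l \<le> fstar - b"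
proof -
  show lu: "l < u" using V_strict_decreasing[OF assms(1,2)] assms by simp
  have "(fstar - a) * l \<le> (fstar - a) * V b"
    using assms by (intro mult_left_mono) auto
  also have "\<dots> \<le> (fstar - b) * V a" by (rule V_chord[OF assms(1,2)])
  also have "\<dots> \<le> (fstar - b) * u" using assms by (intro mult_left_mono) auto
  finally show "(b - a) / (u - l) * l \<le> fstar - b"
    using lu by (simp add: field_simps)
qed

end

text \<open>The step that would follow \<open>\<eta> t\<close>, also when the run ends at \<open>t\<close>, so that the decay argument
  covers the last pair too.\<close>

definition secant_increment ::
  "real \<Rightarrow> (nat \<Rightarrow> real) \<Rightarrow> (nat \<Rightarrow> real) \<Rightarrow> (nat \<Rightarrow> real) \<Rightarrow> nat \<Rightarrow> real" where
  "secant_increment \<beta> \<eta> l u t =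
     \<beta> * max 1 ((\<eta> t - \<eta> (t - 1)) / (u (t - 1) - l t)) * l t"

section \<open>Monotone iterates that do not pass the root\<close>

locale secant_method = decreasing_to_root +
  fixes \<alpha> \<beta> \<epsilon> :: real and \<eta> l u :: "nat \<Rightarrow> real" and N :: nat
  assumes eps: "0 < \<epsilon>"
    and beta: "\<beta> \<in> {1/2<..1}"
    and alpha: "\<alpha> \<in> {1<..<2 * sqrt \<beta>}"
    and start: "\<eta> 0 < \<eta> 1" "\<eta> 1 < fstar"
    and run: "secant_run V \<alpha> \<beta> \<epsilon> \<eta> l u N"
begin

abbreviation D :: real where "D \<equiv> min_of (subdiff V fstar)"

lemma N_pos: "1 \<le> N"
  using run by (simp add: secant_run_def)

lemma step:
  assumes "1 \<le> t" "t < N"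
  shows "\<eta> (Suc t) = \<eta> t + secant_increment \<beta> \<eta> l u t"
proof -
  have "\<eta> (Suc t) = \<eta> (Suc t - 1) + \<beta> * max 1 (- ((\<eta> (Suc t - 2) - \<eta> (Suc t - 1)) /
      (u (Suc t - 2) - l (Suc t - 1)))) * l (Suc t - 1)"
    using run assms unfolding secant_run_def by (metis Suc_1 Suc_le_mono atLeastAtMost_iff Suc_leI)
  moreover have "Suc t - 2 = t - 1" "Suc t - 1 = t" using assms by auto
  ultimately show ?thesis
    by (simp only: secant_increment_def minus_divide_left minus_diff_eq)
qed

lemma pair_found_before: "t < N \<or> t \<le> 1 \<Longrightarrow> pair_found V \<alpha> \<eta> l u t"
proof -
  assume t: "t < N \<or> t \<le> 1"
  consider "t = 0" | "t = 1" | "2 \<le> t" "t < N" using t by linarith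
  then show ?thesis using run by cases (auto simp: secant_run_def)
qed

lemma pair_found_bounds:
  assumes "pair_found V \<alpha> \<eta> l u t"
  shows "0 < l t" "l t \<le> V (\<eta> t)" "V (\<eta> t) \<le> u t" "u t \<le> \<alpha> * l t" "\<eta> t < fstar"
  using assms V_pos_iff[of "\<eta> t"]
  by (auto simp: pair_found_def bracket_def pos_divide_le_eq)

lemma secant_increment_ge:
  assumes "pair_found V \<alpha> \<eta> l u t"
  shows "\<beta> * l t \<le> secant_increment \<beta> \<eta> l u t"
proof -
  have "\<beta> * 1 * l t \<le> secant_increment \<beta> \<eta> l u t"
    unfolding secant_increment_def
    using beta pair_found_bounds[OF assms] by (intro mult_mono) auto
  then show ?thesis by simp
qed

text \<open>Both arguments of \<open>max\<close> undershoot: the fixed point step because slopes are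
  at least -1, the other by \<open>secant_step_bound\<close>. Damping by \<beta> \<le> 1 only
  shortens the step.\<close>

lemma secant_increment_le:
  assumes "1 \<le> t" "pair_found V \<alpha> \<eta> l u (t - 1)" "pair_found V \<alpha> \<eta> l u t" "\<eta> (t - 1) < \<eta> t"
  shows "secant_increment \<beta> \<eta> l u t \<le> fstar - \<eta> t"
proof -
  note t = pair_found_bounds[OF assms(3)] and t' = pair_found_bounds[OF assms(2)]
  have "l t \<le> fstar - \<eta> t" using t V_le_gap[of "\<eta> t"] by linarith
  moreover have "(\<eta> t - \<eta> (t - 1)) / (u (t - 1) - l t) * l t \<le> fstar - \<eta> t"
    using assms t t' by (intro secant_step_bound(2)) auto
  ultimately have "max 1 ((\<eta> t - \<eta> (t - 1)) / (u (t - 1) - l t)) * l t \<le> fstar - \<eta> t"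
    by (auto simp: max_def)
  moreover have "secant_increment \<beta> \<eta> l u t \<le>
      1 * (max 1 ((\<eta> t - \<eta> (t - 1)) / (u (t - 1) - l t)) * l t)"
    unfolding secant_increment_def mult.assoc
    using beta t(1) by (intro mult_right_mono mult_nonneg_nonneg) auto
  ultimately show ?thesis by linarith
qed

lemma increasing:
  assumes "t < N"
  shows "\<eta> t < \<eta> (Suc t)"
proof (cases "t = 0")
  case True
  then show ?thesis using start by simp
next
  case False
  have pf: "pair_found V \<alpha> \<eta> l u t" using pair_found_before assms by blast
  have "0 < \<beta> * l t" using beta pair_found_bounds(1)[OF pf] by simp
  then show ?thesis
    using step[of t] False assms secant_increment_ge[OF pf] by simp
qed

lemma strict_mono_run: "strict_mono_on {0..N} \<eta>"
proof (rule strict_mono_onI)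
  fix r s :: nat
  assume "r \<in> {0..N}" "s \<in> {0..N}" "r < s"
  then have "r < s" "s \<le> N" by auto
  then show "\<eta> r < \<eta> s"
  proof (induction s)
    case (Suc s)
    then show ?case using increasing[of s] by (cases "r = s") auto
  qed simp
qed

text \<open>No induction is involved: the two pairs found before \<open>\<eta> t\<close> already
  place their iterates left of the root. Only \<open>\<eta> N\<close>, where a pair may be missing,
  can equal \<open>fstar\<close>.\<close>

lemma below_root:
  assumes "t \<le> N"
  shows "\<eta> t \<le> fstar"
proof (cases "t \<le> 1")
  case True
  then show ?thesis
    using pair_found_bounds(5)[OF pair_found_before[of t]] by simp
next
  case False
  define s where "s = t - 1"
  have s: "t = Suc s" "1 \<le> s" "s < N" using False assms by (auto simp: s_def)
  have "pair_found V \<alpha> \<eta> l u (s - 1)" "pair_found V \<alpha> \<eta> l u s"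
    using s by (auto intro!: pair_found_before)
  moreover have "\<eta> (s - 1) < \<eta> s" using increasing[of "s - 1"] s by simp
  ultimately have "secant_increment \<beta> \<eta> l u s \<le> fstar - \<eta> s"
    using s by (intro secant_increment_le)
  then show ?thesis using step[of s] s by simp
qed

section \<open>Contraction of the gap and the first iteration bound\<close>

lemma contraction_of_increment:
  assumes "pair_found V \<alpha> \<eta> l u t" "\<eta> t + \<beta> * l t \<le> b"
  shows "fstar - b \<le> (1 + \<beta> / \<alpha> * D) * (fstar - \<eta> t)"
proof -
  note t = pair_found_bounds[OF assms(1)]
  \<comment> \<open>The left side is at most \<open>V (\<eta> t) \<le> u t\<close>; passing from
    \<open>u t\<close> to \<open>l t\<close> costs the factor \<alpha>.\<close>
  have "- D * (fstar - \<eta> t) \<le> \<alpha> * l t"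
    using min_subgradient(1)[of "\<eta> t"] t by linarith
  then have "\<beta> / \<alpha> * (- D * (fstar - \<eta> t)) \<le> \<beta> / \<alpha> * (\<alpha> * l t)"
    using alpha beta by (intro mult_left_mono) auto
  also have "\<dots> = \<beta> * l t" using alpha by simp
  finally have "\<beta> / \<alpha> * (- D * (fstar - \<eta> t)) \<le> \<beta> * l t" .
  moreover have "(1 + \<beta> / \<alpha> * D) * (fstar - \<eta> t) =
      (fstar - \<eta> t) - \<beta> / \<alpha> * (- D * (fstar - \<eta> t))"
    by (simp add: distrib_right)
  ultimately show ?thesis using assms(2) by linarith
qed

lemma contraction:
  assumes "t \<in> {2..N}"
  shows "fstar - \<eta> t \<le> (1 + \<beta> / \<alpha> * D) * (fstar - \<eta> (t - 1))"
proof -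
  have pf: "pair_found V \<alpha> \<eta> l u (t - 1)" using assms by (intro pair_found_before) auto
  show ?thesis
    using step[of "t - 1"] secant_increment_ge[OF pf] assms
    by (intro contraction_of_increment[OF pf]) auto
qed

lemma fixed_point_contraction:
  assumes "fixed_point_start V \<alpha> \<beta> \<eta> l u" "t \<in> {1..N}"
  shows "fstar - \<eta> t \<le> (1 + \<beta> / \<alpha> * D) * (fstar - \<eta> (t - 1))"
proof (cases "t = 1")
  case True
  then show ?thesis
    using assms contraction_of_increment[OF pair_found_before[of 0], of "\<eta> 1"]
    by (simp add: fixed_point_start_def)
next
  case False
  then show ?thesis using contraction assms by auto
qed

text \<open>Follows from D \<ge> -1 and \<beta> \<le> 1 < \<alpha>. Positivity lets the contraction
  be iterated and its factor be put under \<open>ln\<close>.\<close>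

lemma factor_pos: "0 < 1 + \<beta> / \<alpha> * D"
proof -
  have "\<beta> / \<alpha> * (- D) \<le> \<beta> / \<alpha> * 1"
    using alpha beta min_subgradient(3) by (intro mult_left_mono) auto
  also have "\<dots> < 1" using alpha beta by simp
  finally show ?thesis by simp
qed

text \<open>While the test fails, \<open>\<epsilon> < u t \<le> \<alpha> * V (\<eta> t)\<close>, and
  \<open>V (\<eta> t)\<close> is at most the gap, which shrinks like \<open>\<sigma> ^ t\<close>
  from at most \<open>V (\<eta> 0) / - D\<close>.\<close>

lemma contraction_iteration_bound:
  assumes contr: "\<And>t. t \<in> {1..N} \<Longrightarrow> fstar - \<eta> t \<le> (1 + \<beta> / \<alpha> * D) * (fstar - \<eta> (t - 1))"
    and "D \<noteq> 0" "t \<le> N" and pf: "pair_found V \<alpha> \<eta> l u t" and "\<epsilon> < u t"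
  shows "real t < \<alpha> / (- \<beta> * D) * ln (\<alpha> * V (\<eta> 0) / (- D * \<epsilon>))"
proof -
  define \<sigma> where "\<sigma> = 1 + \<beta> / \<alpha> * D"
  have \<sigma>: "0 < \<sigma>" using factor_pos by (simp add: \<sigma>_def)
  have D: "0 < - D" using min_subgradient(2) \<open>D \<noteq> 0\<close> by simp
  have ab: "0 < \<alpha>" "0 < \<beta>" using alpha beta by auto
  have gap: "fstar - \<eta> s \<le> \<sigma> ^ s * (fstar - \<eta> 0)" if "s \<le> N" for s
    using that
  proof (induction s)
    case (Suc s)
    have "fstar - \<eta> (Suc s) \<le> \<sigma> * (fstar - \<eta> s)"
      using contr[of "Suc s"] Suc.prems by (simp add: \<sigma>_def)
    also have "\<dots> \<le> \<sigma> * (\<sigma> ^ s * (fstar - \<eta> 0))"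
      using Suc \<sigma> by (intro mult_left_mono) auto
    finally show ?case by (simp add: mult.assoc)
  qed simp
  have V0: "0 < V (\<eta> 0)" using start by (intro V_pos) auto
  define C where "C = \<alpha> * V (\<eta> 0) / (- D * \<epsilon>)"
  have C: "0 < C" unfolding C_def using ab V0 D eps by (intro divide_pos_pos mult_pos_pos) auto
  have "V (\<eta> t) \<le> \<sigma> ^ t * (fstar - \<eta> 0)"
    using V_le_gap[OF below_root[OF \<open>t \<le> N\<close>]] gap[OF \<open>t \<le> N\<close>] by linarith
  also have "\<dots> \<le> \<sigma> ^ t * (V (\<eta> 0) / - D)"
    using min_subgradient(1)[of "\<eta> 0"] D \<sigma> by (intro mult_left_mono) (auto simp: field_simps)
  finally have "\<alpha> * V (\<eta> t) \<le> \<alpha> * (\<sigma> ^ t * (V (\<eta> 0) / - D))"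
    using ab by (intro mult_left_mono) auto
  also have "\<dots> = \<sigma> ^ t * C * \<epsilon>" using D eps by (simp add: C_def field_simps)
  finally have "\<alpha> * V (\<eta> t) \<le> \<sigma> ^ t * C * \<epsilon>" .
  moreover have "u t \<le> \<alpha> * V (\<eta> t)"
    using pair_found_bounds[OF pf] ab
    by (meson mult_le_cancel_left_pos order_trans)
  ultimately have "1 * \<epsilon> < \<sigma> ^ t * C * \<epsilon>" using \<open>\<epsilon> < u t\<close> by linarith
  then have "1 < \<sigma> ^ t * C" using eps by (simp only: mult_less_cancel_right_pos)
  then have "0 < ln (\<sigma> ^ t * C)" by simp
  then have "0 < real t * ln \<sigma> + ln C"
    using \<sigma> C by (simp add: ln_mult ln_realpow)
  \<comment> \<open>Replacing \<open>ln \<sigma>\<close> by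
    \<open>\<sigma> - 1 = \<beta> / \<alpha> * D\<close> yields the prefactor of the bound.\<close>
  moreover have "real t * ln \<sigma> \<le> real t * (\<sigma> - 1)"
    using ln_le_minus_one[OF \<sigma>] by (intro mult_left_mono) auto
  ultimately have "real t * (- \<beta> * D / \<alpha>) < ln C" by (simp add: \<sigma>_def)
  moreover have "0 < - \<beta> * D / \<alpha>" using ab D by (simp add: divide_less_0_iff mult_less_0_iff)
  ultimately have "real t < ln C / (- \<beta> * D / \<alpha>)" by (simp only: pos_less_divide_eq)
  then show ?thesis by (simp add: C_def mult.commute)
qed

section \<open>Decay of the lower bounds and the second iteration bound\<close>

lemma lower_bound_decay:
  assumes "1 \<le> t" "pair_found V \<alpha> \<eta> l u (t - 1)" "pair_found V \<alpha> \<eta> l u t" "\<eta> (t - 1) < \<eta> t"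
  shows "l t / sqrt (secant_increment \<beta> \<eta> l u t)
    \<le> \<alpha> / (2 * sqrt \<beta>) * (l (t - 1) / sqrt (\<eta> t - \<eta> (t - 1)))"
proof -
  note t = pair_found_bounds[OF assms(3)] and t' = pair_found_bounds[OF assms(2)]
  define \<delta> \<Delta> where "\<delta> = \<eta> t - \<eta> (t - 1)" and "\<Delta> = secant_increment \<beta> \<eta> l u t"
  have \<beta>: "0 < \<beta>" using beta by simp
  have \<delta>: "0 < \<delta>" using assms by (simp add: \<delta>_def)
  have \<Delta>: "0 < \<Delta>"
    using secant_increment_ge[OF assms(3)] mult_pos_pos[OF \<beta> t(1)] by (simp add: \<Delta>_def)
  have ul: "l t < u (t - 1)"
    using secant_step_bound(1)[OF assms(4) t(5) t'(3) t(1,2)] .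
  have "\<beta> * (\<delta> / (u (t - 1) - l t)) * l t \<le> \<Delta>"
    unfolding \<Delta>_def \<delta>_def secant_increment_def using \<beta> t(1)
    by (intro mult_left_mono mult_right_mono) auto
  then have "\<beta> * \<delta> * l t \<le> \<Delta> * (u (t - 1) - l t)"
    using ul by (simp add: pos_divide_le_eq)
  then have "\<beta> * \<delta> * l t + \<Delta> * l t \<le> u (t - 1) * \<Delta>"
    by (simp add: algebra_simps)
  \<comment> \<open>The arithmetic-geometric mean inequality is the source of the constant
    \<open>2 * sqrt \<beta>\<close>.\<close>
  moreover have "2 * (sqrt (\<beta> * \<delta>) * sqrt \<Delta>) \<le> \<beta> * \<delta> + \<Delta>"
    using arith_geo_mean_sqrt[of "\<beta> * \<delta>" \<Delta>] \<beta> \<delta> \<Delta> by (simp add: real_sqrt_mult)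
  then have "2 * (sqrt (\<beta> * \<delta>) * sqrt \<Delta>) * l t \<le> (\<beta> * \<delta> + \<Delta>) * l t"
    using t(1) by (intro mult_right_mono) auto
  ultimately have "2 * (sqrt (\<beta> * \<delta>) * sqrt \<Delta>) * l t \<le> u (t - 1) * \<Delta>"
    by (simp add: algebra_simps)
  also have "\<dots> \<le> \<alpha> * l (t - 1) * \<Delta>" using t'(4) \<Delta> by (intro mult_right_mono) auto
  also have "\<dots> = \<alpha> * l (t - 1) * sqrt \<Delta> * sqrt \<Delta>" using \<Delta> by simp
  finally have "(2 * sqrt \<beta> * sqrt \<delta> * l t) * sqrt \<Delta> \<le> (\<alpha> * l (t - 1) * sqrt \<Delta>) * sqrt \<Delta>"
    by (simp add: real_sqrt_mult algebra_simps)
  then have "2 * sqrt \<beta> * sqrt \<delta> * l t \<le> \<alpha> * l (t - 1) * sqrt \<Delta>"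
    using \<Delta> by (simp only: mult_le_cancel_right_pos real_sqrt_gt_zero)
  then have "l t / sqrt \<Delta> \<le> \<alpha> / (2 * sqrt \<beta>) * (l (t - 1) / sqrt \<delta>)"
    using \<beta> \<delta> \<Delta> by (simp add: field_simps)
  then show ?thesis by (simp add: \<delta>_def \<Delta>_def)
qed

lemma lower_bound_geometric:
  assumes "1 \<le> t" "t \<le> N" "pair_found V \<alpha> \<eta> l u t"
  shows "l t / sqrt (secant_increment \<beta> \<eta> l u t)
    \<le> (\<alpha> / (2 * sqrt \<beta>)) ^ t * (l 0 / sqrt (\<eta> 1 - \<eta> 0))"
  using assms
proof (induction t rule: nat_induct_at_least)
  case base
  then show ?case
    using lower_bound_decay[of 1] pair_found_before[of 0] start by simp
next
  case (Suc t)
  have pf: "pair_found V \<alpha> \<eta> l u t" using Suc by (intro pair_found_before) auto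
  have "l (Suc t) / sqrt (secant_increment \<beta> \<eta> l u (Suc t))
      \<le> \<alpha> / (2 * sqrt \<beta>) * (l t / sqrt (\<eta> (Suc t) - \<eta> t))"
    using lower_bound_decay[of "Suc t"] pf Suc.prems increasing[of t] by simp
  \<comment> \<open>Since \<open>t < N\<close>, this increment was really taken, which links
    consecutive instances of the decay.\<close>
  also have "\<eta> (Suc t) - \<eta> t = secant_increment \<beta> \<eta> l u t"
    using step[of t] Suc by simp
  also have "\<alpha> / (2 * sqrt \<beta>) * (l t / sqrt (secant_increment \<beta> \<eta> l u t))
      \<le> \<alpha> / (2 * sqrt \<beta>) * ((\<alpha> / (2 * sqrt \<beta>)) ^ t * (l 0 / sqrt (\<eta> 1 - \<eta> 0)))"
    using Suc pf alpha beta by (intro mult_left_mono) auto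
  finally show ?case by (simp add: mult.assoc)
qed

text \<open>The normalisation is removed by \<open>\<Delta> \<le> fstar - \<eta> 0\<close>: even a
  step not taken by the run would not pass the root. The decay starts at index 1; at index 0 it
  suffices that the square root is at least 1.\<close>

lemma lower_bound_le:
  assumes "t \<le> N" and pf: "pair_found V \<alpha> \<eta> l u t"
  shows "l t \<le> (\<alpha> / (2 * sqrt \<beta>)) ^ t * (l 0 * sqrt ((fstar - \<eta> 0) / (\<eta> 1 - \<eta> 0)))"
proof (cases "t = 0")
  case True
  have "1 \<le> (fstar - \<eta> 0) / (\<eta> 1 - \<eta> 0)" using start by simp
  then have "1 \<le> sqrt ((fstar - \<eta> 0) / (\<eta> 1 - \<eta> 0))" by simp
  then have "l 0 * 1 \<le> l 0 * sqrt ((fstar - \<eta> 0) / (\<eta> 1 - \<eta> 0))"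
    using pair_found_bounds(1)[OF pf] True by (intro mult_left_mono) auto
  then show ?thesis using True by simp
next
  case False
  define \<Delta> where "\<Delta> = secant_increment \<beta> \<eta> l u t"
  have "0 < \<beta> * l t" using beta pair_found_bounds(1)[OF pf] by simp
  then have \<Delta>: "0 < \<Delta>" using secant_increment_ge[OF pf] by (simp add: \<Delta>_def)
  have "pair_found V \<alpha> \<eta> l u (t - 1)" using False \<open>t \<le> N\<close> by (intro pair_found_before) auto
  then have "\<Delta> \<le> fstar - \<eta> t"
    unfolding \<Delta>_def using False assms increasing[of "t - 1"]
    by (intro secant_increment_le) auto
  moreover have "\<eta> 0 < \<eta> t"
    using strict_mono_onD[OF strict_mono_run] False \<open>t \<le> N\<close> by simp
  ultimately have le: "sqrt \<Delta> \<le> sqrt (fstar - \<eta> 0)" by simp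
  have "l t \<le> (\<alpha> / (2 * sqrt \<beta>)) ^ t * (l 0 / sqrt (\<eta> 1 - \<eta> 0)) * sqrt \<Delta>"
    using lower_bound_geometric[of t] False assms \<Delta> by (simp add: \<Delta>_def pos_divide_le_eq)
  also have "\<dots> \<le> (\<alpha> / (2 * sqrt \<beta>)) ^ t * (l 0 / sqrt (\<eta> 1 - \<eta> 0)) * sqrt (fstar - \<eta> 0)"
    using le alpha beta start pair_found_bounds(1)[OF pair_found_before[of 0]]
    by (intro mult_left_mono mult_nonneg_nonneg) auto
  finally show ?thesis by (simp add: real_sqrt_divide)
qed

lemma geometric_iteration_bound:
  assumes "t \<le> N" and pf: "pair_found V \<alpha> \<eta> l u t" and "\<epsilon> < u t"
  shows "real t < log (2 * sqrt \<beta> / \<alpha>) (\<alpha> * l 0 / \<epsilon> * sqrt ((fstar - \<eta> 0) / (\<eta> 1 - \<eta> 0)))"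
proof -
  define b where "b = 2 * sqrt \<beta> / \<alpha>"
  define R where "R = sqrt ((fstar - \<eta> 0) / (\<eta> 1 - \<eta> 0))"
  \<comment> \<open>This is the hypothesis \<alpha> < 2 \<open>sqrt\<close> \<beta>; it makes the
    logarithm to base \<open>b\<close> increasing.\<close>
  have b: "1 < b" using alpha by (simp add: b_def)
  have "\<epsilon> < \<alpha> * l t" using pair_found_bounds(4)[OF pf] \<open>\<epsilon> < u t\<close> by simp
  also have "\<dots> \<le> \<alpha> * ((\<alpha> / (2 * sqrt \<beta>)) ^ t * (l 0 * R))"
    using lower_bound_le[OF assms(1,2)] alpha unfolding R_def by (intro mult_left_mono) auto
  also have "\<alpha> / (2 * sqrt \<beta>) = inverse b" by (simp add: b_def)
  finally have "b ^ t < \<alpha> * l 0 / \<epsilon> * R"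
    using b eps by (simp add: field_simps power_inverse)
  then have "real t < log b (\<alpha> * l 0 / \<epsilon> * R)" using b by (rule less_log_of_power)
  then show ?thesis by (simp only: b_def R_def)
qed

text \<open>Strictness of both real bounds is what carries over to the ceiling; for
  \<open>D = 0\<close> only the second bound is available.\<close>

lemma iteration_bound:
  assumes "fixed_point_start V \<alpha> \<beta> \<eta> l u"
    and "t \<le> N" "pair_found V \<alpha> \<eta> l u t" "\<epsilon> < u t"
  shows "int t < secant_bound V fstar D \<alpha> \<beta> \<epsilon> (\<eta> 0) (\<eta> 1) (l 0)"
  using contraction_iteration_bound[OF fixed_point_contraction[OF assms(1)] _ assms(2-)]
    geometric_iteration_bound[OF assms(2-)]
  by (auto simp: secant_bound_def Let_def less_ceiling_iff)

end

section \<open>The value function of the constrained problem\<close>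

lemma level_fun_le_iff:
  "level_fun f g m x \<tau> \<le> c \<longleftrightarrow> f x - \<tau> \<le> c \<and> (\<forall>i\<in>{1..m}. g i x \<le> c)"
  by (auto simp: level_fun_def)

lemma level_fun_ge:
  "f x - \<tau> \<le> level_fun f g m x \<tau>" "i \<in> {1..m} \<Longrightarrow> g i x \<le> level_fun f g m x \<tau>"
  using level_fun_le_iff[of f g m x \<tau> "level_fun f g m x \<tau>"] by auto

lemma eps_optimalI:
  assumes "x \<in> X" "level_fun f g m x \<tau> \<le> \<epsilon>" "\<tau> \<le> opt_value X f g m" "0 \<le> \<epsilon>"
  shows "eps_optimal X f g m \<epsilon> x"
  using assms unfolding eps_optimal_def level_fun_le_iff by auto

text \<open>The level function is jointly convex in point and level, and minimising over a convex
  set preserves convexity. The rest comes from using a minimiser at one level as competitor at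
  another, and from the feasibility of points of nonpositive level.\<close>

lemma value_fun_decreasing_to_root:
  fixes X :: "(real^'d) set"
  assumes "convex X" and convex_f: "convex_on UNIV f"
    and convex_g: "\<And>i. i \<in> {1..m} \<Longrightarrow> convex_on UNIV (g i)"
    and fstar: "has_min (f ` feasible X g m)"
    and attained: "\<And>\<tau>. has_min ((\<lambda>x. level_fun f g m x \<tau>) ` X)"
  shows "decreasing_to_root (value_fun X f g m) (opt_value X f g m)"
proof
  let ?V = "value_fun X f g m"
  have minimizer: "\<exists>x\<in>X. ?V \<tau> = level_fun f g m x \<tau>" for \<tau>
    using min_of_properties(1)[OF attained[of \<tau>]] unfolding value_fun_def by auto
  have V_le: "?V \<tau> \<le> c" if "x \<in> X" "level_fun f g m x \<tau> \<le> c" for \<tau> x c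
    using min_of_properties(2)[OF attained[of \<tau>], of "level_fun f g m x \<tau>"] that
    unfolding value_fun_def by fastforce
  show "convex_on UNIV ?V"
  proof (rule convex_onI)
    fix s a b :: real
    assume s: "0 < s" "s < 1"
    obtain x where x: "x \<in> X" "?V a = level_fun f g m x a" using minimizer by blast
    obtain y where y: "y \<in> X" "?V b = level_fun f g m y b" using minimizer by blast
    have comb: "h ((1 - s) *\<^sub>R x + s *\<^sub>R y) \<le> (1 - s) * p + s * q"
      if "convex_on UNIV h" "h x \<le> p" "h y \<le> q" for h :: "real^'d \<Rightarrow> real" and p q
    proof -
      have "h ((1 - s) *\<^sub>R x + s *\<^sub>R y) \<le> (1 - s) * h x + s * h y"
        using convex_onD[OF that(1)] s by simp
      also have "\<dots> \<le> (1 - s) * p + s * q"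
        using that s by (intro add_mono mult_left_mono) auto
      finally show ?thesis .
    qed
    show "?V ((1 - s) *\<^sub>R a + s *\<^sub>R b) \<le> (1 - s) * ?V a + s * ?V b"
    proof (rule V_le)
      show "(1 - s) *\<^sub>R x + s *\<^sub>R y \<in> X"
        using \<open>convex X\<close> x y s by (simp add: convex_alt)
      have "f ((1 - s) *\<^sub>R x + s *\<^sub>R y) \<le> (1 - s) * (?V a + a) + s * (?V b + b)"
        using level_fun_ge(1)[of f x a g m] level_fun_ge(1)[of f y b g m] x y
        by (intro comb[OF convex_f]) auto
      moreover have "g i ((1 - s) *\<^sub>R x + s *\<^sub>R y) \<le> (1 - s) * ?V a + s * ?V b"
        if "i \<in> {1..m}" for i
        using level_fun_ge(2)[OF that] x y by (intro comb[OF convex_g[OF that]]) auto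
      ultimately show "level_fun f g m ((1 - s) *\<^sub>R x + s *\<^sub>R y) ((1 - s) *\<^sub>R a + s *\<^sub>R b)
          \<le> (1 - s) * ?V a + s * ?V b"
        unfolding level_fun_le_iff by (auto simp: algebra_simps)
    qed
  qed simp
  show "antimono ?V"
  proof (rule antimonoI)
    fix a b :: real
    assume "a \<le> b"
    obtain x where x: "x \<in> X" "?V a = level_fun f g m x a" using minimizer by blast
    show "?V b \<le> ?V a"
      using level_fun_ge(1)[of f x a g m] level_fun_ge(2)[where f = f and g = g and m = m and x = x and \<tau> = a] x \<open>a \<le> b\<close>
      by (intro V_le[OF x(1)]) (auto simp: level_fun_le_iff)
  qed
  show "?V a \<le> ?V b + (b - a)" if "a \<le> b" for a b
  proof -
    obtain x where x: "x \<in> X" "?V b = level_fun f g m x b" using minimizer by blast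
    \<comment> \<open>At the minimiser for \<open>b\<close>, lowering the level to \<open>a\<close>
      raises the objective entry by \<open>b - a\<close> and leaves the constraint entries
      unchanged.\<close>
    show ?thesis
      using level_fun_ge(1)[of f x b g m] level_fun_ge(2)[where f = f and g = g and m = m and x = x and \<tau> = b] x that
      by (intro V_le[OF x(1)]) (force simp: level_fun_le_iff)
  qed
  have opt_le: "opt_value X f g m \<le> f x" if "x \<in> feasible X g m" for x
    using min_of_properties(2)[OF fstar] that unfolding opt_value_def by blast
  show pos: "0 < ?V a" if "a < opt_value X f g m" for a
  proof (rule ccontr)
    assume "\<not> 0 < ?V a"
    moreover obtain x where x: "x \<in> X" "?V a = level_fun f g m x a" using minimizer by blast
    ultimately have "f x \<le> a" "x \<in> feasible X g m"
      using level_fun_le_iff[of f g m x a 0] by (auto simp: feasible_def)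
    then show False using opt_le that by fastforce
  qed
  show "?V (opt_value X f g m) = 0"
  proof (rule antisym)
    obtain x where x: "x \<in> feasible X g m" "opt_value X f g m = f x"
      using min_of_properties(1)[OF fstar] unfolding opt_value_def by auto
    then show "?V (opt_value X f g m) \<le> 0"
      by (intro V_le[of x]) (auto simp: feasible_def level_fun_le_iff)
    show "0 \<le> ?V (opt_value X f g m)"
    proof (rule ccontr)
      assume neg: "\<not> 0 \<le> ?V (opt_value X f g m)"
      obtain y where y: "y \<in> X" "?V (opt_value X f g m) = level_fun f g m y (opt_value X f g m)"
        using minimizer by blast
      have "y \<in> feasible X g m" "f y < opt_value X f g m"
        using neg y level_fun_ge(1)[of f y "opt_value X f g m" g m]
          level_fun_ge(2)[where f = f and g = g and m = m and x = y and \<tau> = "opt_value X f g m"]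
        by (force simp: feasible_def)+
      then show False using opt_le by fastforce
    qed
  qed
qed

text \<open>\<open>N\<close> is any iteration the run has entered. For a general start
  \<open>\<eta> 1\<close> may be too close to \<open>\<eta> 0\<close> for contraction at index 1, so
  that clause begins at 2. The accuracy test is first made at index 2, which makes an already
  accurate pair at index 1 a separate case.\<close>

theorem theorem3p5:
  fixes X :: "(real^'d) set"
    and f :: "real^'d \<Rightarrow> real"
    and g :: "nat \<Rightarrow> real^'d \<Rightarrow> real"
    and m N :: nat
    and \<alpha> \<beta> \<epsilon> :: real
    and \<eta> l u :: "nat \<Rightarrow> real"
  defines "fstar \<equiv> opt_value X f g m"
    and "V \<equiv> value_fun X f g m"
  defines "D \<equiv> min_of (subdiff V fstar)"
  defines "\<sigma> \<equiv> 1 + \<beta> / \<alpha> * D"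
    and "T \<equiv> secant_bound V fstar D \<alpha> \<beta> \<epsilon> (\<eta> 0) (\<eta> 1) (l 0)"
  assumes X: "X \<noteq> {}" "closed X" "convex X"
    and convex_f: "convex_on UNIV f"
    and convex_g: "\<And>i. i \<in> {1..m} \<Longrightarrow> convex_on UNIV (g i)"
    and fstar_attained: "has_min (f ` feasible X g m)"
    and V_attained: "\<And>\<tau>. has_min ((\<lambda>x. level_fun f g m x \<tau>) ` X)"
    and eps: "\<epsilon> > 0"
    and beta: "\<beta> \<in> {1/2<..1}"
    and alpha: "\<alpha> \<in> {1<..<2 * sqrt \<beta>}"
    and start: "\<eta> 0 < \<eta> 1" "\<eta> 1 < fstar"
    and run: "secant_run V \<alpha> \<beta> \<epsilon> \<eta> l u N"
  shows
    "strict_mono_on {0..N} \<eta> \<and>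
     (\<forall>t\<in>{1..N}. \<eta> t \<le> fstar) \<and>
     has_min (subdiff V fstar) \<and>
     (\<forall>t\<in>{2..N}. fstar - \<eta> t \<le> \<sigma> * (fstar - \<eta> (t - 1))) \<and>
     (\<forall>t\<le>N. pair_found V \<alpha> \<eta> l u t \<and> u t \<le> \<epsilon> \<longrightarrow>
        (\<exists>x\<in>X. level_fun f g m x (\<eta> t) \<le> u t) \<and>
        (\<forall>x\<in>X. level_fun f g m x (\<eta> t) \<le> u t \<longrightarrow> eps_optimal X f g m \<epsilon> x)) \<and>
     (fixed_point_start V \<alpha> \<beta> \<eta> l u \<longrightarrow>
        (\<forall>t\<in>{1..N}. fstar - \<eta> t \<le> \<sigma> * (fstar - \<eta> (t - 1))) \<and>
        (\<forall>t\<le>N. pair_found V \<alpha> \<eta> l u t \<and> T \<le> int t \<longrightarrow> u t \<le> \<epsilon>) \<and>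
        (\<epsilon> < u 1 \<longrightarrow> int N \<le> T) \<and>
        (u 1 \<le> \<epsilon> \<longrightarrow> N \<le> 2))"
proof -
  interpret decreasing_to_root V fstar
    unfolding V_def fstar_def
    by (rule value_fun_decreasing_to_root[OF X(3) convex_f convex_g fstar_attained V_attained])
  interpret secant_method V fstar \<alpha> \<beta> \<epsilon> \<eta> l u N
    using eps beta alpha start run by unfold_locales
  have stop: "(\<exists>x\<in>X. level_fun f g m x (\<eta> t) \<le> u t) \<and>
      (\<forall>x\<in>X. level_fun f g m x (\<eta> t) \<le> u t \<longrightarrow> eps_optimal X f g m \<epsilon> x)"
    if "t \<le> N" "pair_found V \<alpha> \<eta> l u t" "u t \<le> \<epsilon>" for t
  proof -
    have "V (\<eta> t) \<in> (\<lambda>x. level_fun f g m x (\<eta> t)) ` X"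
      unfolding V_def value_fun_def by (rule min_of_properties(1)[OF V_attained])
    then have "\<exists>x\<in>X. level_fun f g m x (\<eta> t) \<le> u t"
      using pair_found_bounds(3)[OF that(2)] by auto
    moreover have "eps_optimal X f g m \<epsilon> x" if "x \<in> X" "level_fun f g m x (\<eta> t) \<le> u t" for x
      using that \<open>u t \<le> \<epsilon>\<close> below_root[OF \<open>t \<le> N\<close>] eps
      by (intro eps_optimalI[where \<tau> = "\<eta> t"]) (auto simp: fstar_def)
    ultimately show ?thesis by blast
  qed
  have bound: "u t \<le> \<epsilon>"
    if "fixed_point_start V \<alpha> \<beta> \<eta> l u" "t \<le> N" "pair_found V \<alpha> \<eta> l u t" "T \<le> int t" for t
    using iteration_bound[OF that(1-3)] that(4) unfolding T_def D_def by linarith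
  have "int N \<le> T" if fp: "fixed_point_start V \<alpha> \<beta> \<eta> l u" and "\<epsilon> < u 1"
  proof -
    have "\<epsilon> < u (N - 1)"
    proof -
      \<comment> \<open>The three cases use, in turn, \<open>u 1 \<le> u 0\<close> from the fixed
        point step, the assumption on \<open>u 1\<close>, and the failed test recorded in the
        run.\<close>
      consider "N - 1 = 0" | "N - 1 = 1" | "N - 1 \<in> {2..<N}" using N_pos by force
      then show ?thesis
      proof cases
        case 3
        then have "\<not> u (N - 1) \<le> \<epsilon>" using run unfolding secant_run_def by blast
        then show ?thesis by simp
      qed (use fp \<open>\<epsilon> < u 1\<close> in \<open>auto simp: fixed_point_start_def\<close>)
    qed
    then have "\<not> T \<le> int (N - 1)"
      using bound[OF fp, of "N - 1"] pair_found_before[of "N - 1"] N_pos by force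
    then show ?thesis using N_pos by linarith
  qed
  moreover have "N \<le> 2" if "u 1 \<le> \<epsilon>"
  proof (rule ccontr)
    assume "\<not> N \<le> 2"
    \<comment> \<open>Entering iteration 3 requires a failed test at 2, against
      \<open>u 2 \<le> u 1\<close>.\<close>
    then have "pair_found V \<alpha> \<eta> l u 2" "\<not> u 2 \<le> \<epsilon>" using run by (auto simp: secant_run_def)
    then show False using that by (simp add: pair_found_def)
  qed
  ultimately show ?thesis
    unfolding \<sigma>_def D_def
    using strict_mono_run below_root subdiff_root_has_min contraction stop fixed_point_contraction bound
    by auto
qed

end
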